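(* Let $B$ be a normal local ring, let $p$ be a prime number, let $G$ be a cyclic group of order $p$ of local automorphisms of $B$, and let $A := B^G$ be the ring of $G$-invariants. Assume that the augmentation ideal $I_G$ is principal and let $y \in B$ be an augmentation generator. Then $B$ decomposes into the direct sum $$B = A\cdot y^0 \oplus A\cdot y^1 \oplus \cdots \oplus A\cdot y^{p-1}.$$
   Context: A normal local ring is a local integral domain that is integrally closed in its field of fractions. $G$ is a group of automorphisms of $B$, so it acts faithfully. Fix a generator $\sigma$ of $G$. The augmentation map is $I := \sigma - \mathrm{id} : B \to B$, $b \mapsto \sigma(b) - b$. The augmentation ideal is the $B$-ideal $I_G := (I(b) : b \in B)$ generated by the image of $I$; it does not depend on the choice of $\sigma$. An element $y \in B$ is called an augmentation generator if $I_G = B\cdot I(y)$; this notion does not depend on the choice of $\sigma$ either. The direct sum is one of $A$-submodules of $B$. *)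

theory Defs
  imports
    "HOL-Computational_Algebra.Computational_Algebra"
    "HOL-Library.FuncSet"
    "HOL-Algebra.Bij"
    "HOL-Algebra.Generated_Groups"
begin

text \<open>
  A commutative ring \<open>B\<close> is given as a type. It is a module over itself by
  multiplication; its ideals are the \<^const>\<open>module.subspace\<close>s for \<open>(*)\<close> and the ideal
  generated by a set is the \<^const>\<open>module.span\<close> for \<open>(*)\<close>.
\<close>

definition maximal_ideal :: "'a::comm_ring_1 set \<Rightarrow> bool" where
  "maximal_ideal M \<longleftrightarrow>
     module.subspace (*) M \<and> M \<noteq> UNIV \<and>
     (\<forall>J. module.subspace (*) J \<and> M \<subseteq> J \<longrightarrow> J = M \<or> J = UNIV)"

definition local_ring :: "'a::comm_ring_1 itself \<Rightarrow> bool" where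
  "local_ring _ \<longleftrightarrow> (\<exists>!M :: 'a set. maximal_ideal M)"

definition integral_fract :: "'a::idom fract \<Rightarrow> bool" where
  "integral_fract x \<longleftrightarrow>
     (\<exists>q :: 'a poly. lead_coeff q = 1 \<and> poly (map_poly to_fract q) x = 0)"

definition integrally_closed :: "'a::idom itself \<Rightarrow> bool" where
  "integrally_closed _ \<longleftrightarrow> (\<forall>x :: 'a fract. integral_fract x \<longrightarrow> x \<in> range to_fract)"

definition normal_local_ring :: "'a::idom itself \<Rightarrow> bool" where
  "normal_local_ring T \<longleftrightarrow> local_ring T \<and> integrally_closed T"

definition ring_automorphism :: "('a::comm_ring_1 \<Rightarrow> 'a) \<Rightarrow> bool" where
  "ring_automorphism f \<longleftrightarrow>
     bij f \<and> f 1 = 1 \<and> (\<forall>a b. f (a + b) = f a + f b) \<and> (\<forall>a b. f (a * b) = f a * f b)"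

text \<open>On a local ring the quantifier below ranges over the unique maximal ideal only.\<close>

definition local_automorphism :: "('a::comm_ring_1 \<Rightarrow> 'a) \<Rightarrow> bool" where
  "local_automorphism f \<longleftrightarrow>
     ring_automorphism f \<and> (\<forall>M. maximal_ideal M \<longrightarrow> f ` M \<subseteq> M)"

text \<open>
  \<^term>\<open>BijGroup UNIV\<close> is the group of all bijections of the type under composition.
\<close>

definition local_automorphism_group :: "('a::comm_ring_1 \<Rightarrow> 'a) set \<Rightarrow> bool" where
  "local_automorphism_group G \<longleftrightarrow>
     subgroup G (BijGroup UNIV) \<and> (\<forall>g\<in>G. local_automorphism g)"

definition group_generator :: "('a \<Rightarrow> 'a) set \<Rightarrow> ('a \<Rightarrow> 'a) \<Rightarrow> bool" where
  "group_generator G \<sigma> \<longleftrightarrow> \<sigma> \<in> G \<and> generate (BijGroup UNIV) {\<sigma>} = G"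

definition invariants :: "('a \<Rightarrow> 'a) set \<Rightarrow> 'a set" where
  "invariants G = {b. \<forall>g\<in>G. g b = b}"

definition augmentation_map :: "('a::comm_ring_1 \<Rightarrow> 'a) \<Rightarrow> 'a \<Rightarrow> 'a" where
  "augmentation_map \<sigma> b = \<sigma> b - b"

definition augmentation_ideal :: "('a::comm_ring_1 \<Rightarrow> 'a) \<Rightarrow> 'a set" where
  "augmentation_ideal \<sigma> = module.span (*) (range (augmentation_map \<sigma>))"

definition principal_ideal :: "'a::comm_ring_1 set \<Rightarrow> bool" where
  "principal_ideal J \<longleftrightarrow> (\<exists>c. J = module.span (*) {c})"

definition augmentation_generator :: "('a::comm_ring_1 \<Rightarrow> 'a) \<Rightarrow> 'a \<Rightarrow> bool" where
  "augmentation_generator \<sigma> y \<longleftrightarrow>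
     augmentation_ideal \<sigma> = module.span (*) {augmentation_map \<sigma> y}"

definition is_submodule :: "'a::comm_ring_1 set \<Rightarrow> 'a set \<Rightarrow> bool" where
  "is_submodule A N \<longleftrightarrow>
     0 \<in> N \<and> (\<forall>u\<in>N. \<forall>v\<in>N. u + v \<in> N) \<and> (\<forall>a\<in>A. \<forall>u\<in>N. a * u \<in> N)"

text \<open>
  \<open>S\<close> is the internal direct sum of the \<open>A\<close>-submodules \<open>N i\<close>: addition is a bijection from
  the families \<open>(x i)\<close> with \<open>x i \<in> N i\<close> onto \<open>S\<close>. The index set \<open>I\<close> is meant to be finite.
\<close>

definition is_direct_sum ::
  "'a::comm_ring_1 set \<Rightarrow> 'a set \<Rightarrow> 'i set \<Rightarrow> ('i \<Rightarrow> 'a set) \<Rightarrow> bool" where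
  "is_direct_sum A S I N \<longleftrightarrow>
     (\<forall>i\<in>I. is_submodule A (N i)) \<and>
     bij_betw (\<lambda>x. \<Sum>i\<in>I. x i) (\<Pi>\<^sub>E i\<in>I. N i) S"

end

theory Submission
  imports Defs "HOL-Algebra.Multiplicative_Group" "HOL-Number_Theory.Cong"
begin

text \<open>
  Write \<open>y\<^sub>i = \<sigma>\<^sup>i y\<close> and let \<open>A\<close> be the ring of invariants. An expression \<open>b = \<Sum> a\<^sub>j y\<^sup>j\<close> with
  \<open>j < p\<close> and \<open>a\<^sub>j \<in> A\<close> is the same thing as a polynomial \<open>P\<close> over \<open>B\<close> of degree less than \<open>p\<close>
  with \<open>P y\<^sub>i = \<sigma>\<^sup>i b\<close> for all \<open>i < p\<close>. Indeed, applying \<open>\<sigma>\<close> to such an expression gives the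
  interpolation conditions. Conversely, if \<open>P\<close> interpolates, then so does the polynomial
  \<open>\<sigma>P\<close> obtained by applying \<open>\<sigma>\<close> to the coefficients, since \<open>\<sigma>\<close> permutes the \<open>y\<^sub>i\<close>
  cyclically; the \<open>y\<^sub>i\<close> being distinct, \<open>\<sigma>P = P\<close>, so \<open>P\<close> has coefficients in \<open>A\<close>. So the
  theorem says that the interpolation problem is solvable over \<open>B\<close>, uniquely.

  Interpolation needs division by the differences of the nodes. The point is that
  each \<open>y\<^sub>k - y\<close> with \<open>0 < k < p\<close> generates the augmentation ideal
  (\<open>augmentation_generator_power\<close>). This is where locality and the primality of \<open>p\<close> enter: write
  \<open>\<tau> = \<sigma>\<^sup>k\<close> and \<open>\<sigma> = \<tau>\<^sup>m\<close>, and \<open>\<tau> y - y = \<pi> v\<close> with \<open>\<pi> = \<sigma> y - y\<close>. Then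
  \<open>\<pi> = \<Sum> \<tau>\<^sup>i (\<tau> y - y) = \<Sum> \<tau>\<^sup>i \<pi> \<cdot> \<tau>\<^sup>i v\<close> over \<open>i < m\<close>, and \<open>\<pi>\<close> divides each \<open>\<tau>\<^sup>i \<pi>\<close>. Cancelling
  \<open>\<pi>\<close> writes \<open>1\<close> as a sum of multiples of the \<open>\<tau>\<^sup>i v\<close>, so in a local ring some \<open>\<tau>\<^sup>i v\<close>, hence
  \<open>v\<close>, is a unit.

  Since \<open>\<sigma>P - P\<close> has all its coefficients in the augmentation ideal, the recursion of
  Neville's algorithm \<open>P\<^sub>k\<^sub>+\<^sub>1 = P\<^sub>k + (X - y) (\<sigma>P\<^sub>k - P\<^sub>k) / (y\<^sub>k\<^sub>+\<^sub>1 - y)\<close> never leaves \<open>B\<close>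
  (\<open>interpolation_exists\<close>).
\<close>

section \<open>Units in local rings\<close>

lemma module_times: "Modules.module ((*) :: 'a::comm_ring_1 \<Rightarrow> 'a \<Rightarrow> 'a)"
  by unfold_locales (auto simp: algebra_simps)

lemma ideal_iff:
  "module.subspace (*) (J :: 'a::comm_ring_1 set) \<longleftrightarrow>
     0 \<in> J \<and> (\<forall>a\<in>J. \<forall>b\<in>J. a + b \<in> J) \<and> (\<forall>c. \<forall>a\<in>J. c * a \<in> J)"
  by (rule module.subspace_def[OF module_times])

lemma ideal_eq_UNIV:
  fixes J :: "'a::comm_ring_1 set"
  assumes "module.subspace (*) J" "1 \<in> J"
  shows "J = UNIV"
  using assms unfolding ideal_iff by (metis UNIV_eq_I mult.right_neutral)

lemma maximal_ideal_no_unit: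
  fixes M :: "'a::comm_ring_1 set"
  assumes "maximal_ideal M" "x \<in> M"
  shows "\<not> x dvd 1"
proof
  assume "x dvd 1"
  then obtain c where "1 = x * c" by (auto elim: dvdE)
  then have "1 \<in> M" using assms unfolding maximal_ideal_def ideal_iff by (metis mult.commute)
  then show False using assms ideal_eq_UNIV unfolding maximal_ideal_def by blast
qed

lemma nonunit_in_maximal_ideal:
  fixes x :: "'a::comm_ring_1"
  assumes "\<not> x dvd 1"
  obtains M where "maximal_ideal M" "x \<in> M"
proof -
  let ?S = "{J. module.subspace (*) J \<and> x \<in> J \<and> 1 \<notin> J}"
  have "range ((*) x) \<in> ?S"
  proof -
    have "a + b \<in> range ((*) x)" if "a \<in> range ((*) x)" "b \<in> range ((*) x)" for a b
      using that by (auto simp flip: distrib_left)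
    moreover have "c * a \<in> range ((*) x)" if "a \<in> range ((*) x)" for a c
      using that by (auto simp: mult.left_commute[of c x])
    moreover have "0 \<in> range ((*) x)" by (rule range_eqI[of _ _ 0]) simp
    moreover have "x \<in> range ((*) x)" by (rule range_eqI[of _ _ 1]) simp
    moreover have "1 \<notin> range ((*) x)" using assms by (metis dvdI rangeE)
    ultimately show ?thesis unfolding ideal_iff by simp
  qed
  then have ne: "?S \<noteq> {}" by blast
  have "\<Union>C \<in> ?S" if C: "C \<noteq> {}" "subset.chain ?S C" for C
  proof -
    have sub: "C \<subseteq> ?S" using C(2) by (auto simp: subset_chain_def)
    have "a + b \<in> \<Union>C" if ab: "a \<in> \<Union>C" "b \<in> \<Union>C" for a b
    proof -
      from ab obtain J K where J: "J \<in> C" "a \<in> J" and K: "K \<in> C" "b \<in> K" by blast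
      from C(2) J K have "J \<subseteq> K \<or> K \<subseteq> J" by (auto simp: subset_chain_def)
      then obtain L where "L \<in> C" "a \<in> L" "b \<in> L" using J K by blast
      then show ?thesis using sub unfolding ideal_iff by blast
    qed
    moreover have "c * a \<in> \<Union>C" if "a \<in> \<Union>C" for a c
      using that sub unfolding ideal_iff by blast
    moreover have "0 \<in> \<Union>C" "x \<in> \<Union>C" "1 \<notin> \<Union>C"
      using C(1) sub unfolding ideal_iff by blast+
    ultimately show ?thesis unfolding ideal_iff by blast
  qed
  from subset_Zorn_nonempty[OF ne this] obtain M where
    M: "M \<in> ?S" and max: "\<And>J. J \<in> ?S \<Longrightarrow> M \<subseteq> J \<Longrightarrow> J = M" by auto
  have "maximal_ideal M"
    unfolding maximal_ideal_def
  proof (intro conjI allI impI)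
    fix J assume "module.subspace (*) J \<and> M \<subseteq> J"
    then show "J = M \<or> J = UNIV" using M max[of J] ideal_eq_UNIV[of J] by blast
  qed (use M in auto)
  then show thesis using M that by blast
qed

lemma local_ring_unit_add:
  fixes a b :: "'a::comm_ring_1"
  assumes "local_ring TYPE('a)" "a + b dvd 1"
  shows "a dvd 1 \<or> b dvd 1"
proof (rule ccontr)
  assume "\<not> ?thesis"
  then obtain M N where M: "maximal_ideal M" "a \<in> M" and N: "maximal_ideal N" "b \<in> N"
    by (metis nonunit_in_maximal_ideal)
  then have "M = N" using assms(1) unfolding local_ring_def by blast
  then have "a + b \<in> M" using M N unfolding maximal_ideal_def ideal_iff by blast
  then show False using maximal_ideal_no_unit M(1) assms(2) by blast
qed

lemma local_ring_unit_sum: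
  fixes f :: "'i \<Rightarrow> 'a::comm_ring_1"
  assumes "local_ring TYPE('a)" "finite I" "(\<Sum>i\<in>I. f i) dvd 1"
  shows "\<exists>i\<in>I. f i dvd 1"
proof -
  obtain M :: "'a set" where M: "maximal_ideal M"
    using assms(1) unfolding local_ring_def by blast
  then have "0 \<in> M" unfolding maximal_ideal_def ideal_iff by simp
  then have zero: "\<not> (0::'a) dvd 1" by (rule maximal_ideal_no_unit[OF M])
  show ?thesis
    using assms(2,3)
  proof (induction I rule: finite_induct)
    case empty
    then show ?case using zero by simp
  next
    case (insert j J)
    then have "f j dvd 1 \<or> (\<Sum>i\<in>J. f i) dvd 1"
      by (intro local_ring_unit_add[OF assms(1)]) simp
    then show ?case using insert.IH by blast
  qed
qed

section \<open>Augmentation generators of a cyclic action\<close>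

text \<open>
  The action of a group of order \<open>p\<close>, expressed by equations for one generator \<open>\<sigma>\<close>. The
  divisibilities say that \<open>y\<close> is an augmentation generator. Given them, \<open>\<sigma> y \<noteq> y\<close> is the same as
  \<open>\<sigma>\<close> not being the identity.
\<close>

locale cyclic_augmentation =
  fixes \<sigma> :: "'b::idom \<Rightarrow> 'b" and p :: nat and y :: 'b
  assumes hom_one: "\<sigma> 1 = 1"
    and hom_add: "\<sigma> (a + b) = \<sigma> a + \<sigma> b"
    and hom_mult: "\<sigma> (a * b) = \<sigma> a * \<sigma> b"
    and local_ring: "local_ring TYPE('b)"
    and prime: "prime p"
    and order: "\<sigma> ^^ p = id"
    and dvd_diff: "\<sigma> y - y dvd \<sigma> b - b"
    and moves: "\<sigma> y \<noteq> y"
begin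

lemma hom_zero: "\<sigma> 0 = 0"
  using hom_add[of 0 0] by (metis add_0 add_cancel_right_right)

lemma hom_diff: "\<sigma> (a - b) = \<sigma> a - \<sigma> b"
  using hom_add[of "a - b" b] by (simp add: algebra_simps)

lemma hom_sum: "\<sigma> (\<Sum>i\<in>I. f i) = (\<Sum>i\<in>I. \<sigma> (f i))"
  by (induction I rule: infinite_finite_induct) (simp_all add: hom_zero hom_add)

lemma hom_power: "\<sigma> (a ^ n) = \<sigma> a ^ n"
  by (induction n) (simp_all add: hom_one hom_mult)

lemma funpow_one: "(\<sigma> ^^ n) 1 = 1"
  by (induction n) (simp_all add: hom_one)

lemma funpow_diff: "(\<sigma> ^^ n) (a - b) = (\<sigma> ^^ n) a - (\<sigma> ^^ n) b"
  by (induction n) (simp_all add: hom_diff)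

lemma funpow_mult_distrib: "(\<sigma> ^^ n) (a * b) = (\<sigma> ^^ n) a * (\<sigma> ^^ n) b"
  by (induction n) (simp_all add: hom_mult)

lemma funpow_order_mult: "\<sigma> ^^ (p * n) = id"
  by (simp add: funpow_mult[symmetric] order)

lemma funpow_period: "\<sigma> ^^ (a + p * n) = \<sigma> ^^ a"
  by (simp add: funpow_add funpow_order_mult)

lemma funpow_inj: "(\<sigma> ^^ n) a = (\<sigma> ^^ n) b \<Longrightarrow> a = b"
proof -
  assume "(\<sigma> ^^ n) a = (\<sigma> ^^ n) b"
  then have "(\<sigma> ^^ ((p - 1) * n + n)) a = (\<sigma> ^^ ((p - 1) * n + n)) b"
    by (simp only: funpow_add o_apply)
  moreover have "(p - 1) * n + n = p * n"
    using prime_gt_0_nat[OF prime] by (cases p) auto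
  ultimately show "a = b" by (simp add: funpow_order_mult)
qed

lemma funpow_unitD:
  assumes "(\<sigma> ^^ n) a dvd 1"
  shows "a dvd 1"
proof -
  from assms obtain c where c: "1 = (\<sigma> ^^ n) a * c" by (auto elim: dvdE)
  have "(\<sigma> ^^ ((p - 1) * n)) ((\<sigma> ^^ n) a) = a"
  proof -
    have "(p - 1) * n + n = p * n"
      using prime_gt_0_nat[OF prime] by (cases p) auto
    then show ?thesis by (metis comp_apply funpow_add funpow_order_mult id_apply)
  qed
  then have "1 = a * (\<sigma> ^^ ((p - 1) * n)) c"
    using arg_cong[OF c, of "\<sigma> ^^ ((p - 1) * n)"] by (simp add: funpow_one funpow_mult_distrib)
  then show ?thesis by (metis dvdI)
qed

lemma dvd_funpow_diff: "\<sigma> y - y dvd (\<sigma> ^^ n) b - b"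
proof (induction n)
  case (Suc n)
  have "(\<sigma> ^^ Suc n) b - b = (\<sigma> ((\<sigma> ^^ n) b) - (\<sigma> ^^ n) b) + ((\<sigma> ^^ n) b - b)" by simp
  then show ?case using Suc dvd_diff dvd_add by metis
qed simp

lemma dvd_funpow_generator: "\<sigma> y - y dvd (\<sigma> ^^ n) (\<sigma> y - y)"
  using dvd_add[OF dvd_funpow_diff[of n "\<sigma> y - y"] dvd_refl] by simp

lemma exponent_inverse:
  assumes "0 < k" "k < p"
  obtains m where "\<sigma> ^^ (k * m) = \<sigma>"
proof -
  have "coprime k p"
    using assms prime by (metis coprime_commute nat_dvd_not_less prime_imp_coprime)
  then obtain m where "[k * m = 1] (mod p)" using cong_solve_coprime_nat by auto
  then have "(k * m) mod p = 1"
    using prime_gt_1_nat[OF prime] by (simp add: cong_def)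
  then have "k * m = 1 + p * (k * m div p)" by (metis mod_mult_div_eq)
  then have "\<sigma> ^^ (k * m) = \<sigma> ^^ 1" by (metis funpow_period)
  then show thesis using that[of m] by simp
qed

text \<open>
  The augmentation ideal depends only on the group, but whether a given \<open>y\<close> stays a generator
  when \<open>\<sigma>\<close> is replaced by \<open>\<sigma>\<^sup>k\<close> is a question about the cofactor \<open>v\<close> of \<open>\<sigma>\<^sup>k y - y\<close>, which
  locality settles.
\<close>

lemma augmentation_generator_power:
  assumes k: "0 < k" "k < p"
  shows "(\<sigma> ^^ k) y - y dvd \<sigma> y - y"
proof -
  define \<pi> where "\<pi> = \<sigma> y - y"
  have \<pi>0: "\<pi> \<noteq> 0" using moves by (simp add: \<pi>_def)
  obtain v where v: "(\<sigma> ^^ k) y - y = \<pi> * v"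
    using dvd_funpow_diff[of k y] by (auto simp: \<pi>_def elim: dvdE)
  obtain m where m: "\<sigma> ^^ (k * m) = \<sigma>" using exponent_inverse[OF k] .
  obtain w where w: "\<And>n. (\<sigma> ^^ n) \<pi> = \<pi> * w n"
    using dvd_funpow_generator unfolding \<pi>_def[symmetric] dvd_def by metis
  have "\<pi> = (\<sigma> ^^ (k * m)) y - (\<sigma> ^^ (k * 0)) y" by (simp add: \<pi>_def m)
  also have "\<dots> = (\<Sum>i<m. (\<sigma> ^^ (k * Suc i)) y - (\<sigma> ^^ (k * i)) y)"
    by (rule sum_lessThan_telescope[symmetric])
  also have "\<dots> = (\<Sum>i<m. (\<sigma> ^^ (k * i)) ((\<sigma> ^^ k) y - y))"
    by (simp only: funpow_diff mult_Suc_right add.commute[of k] funpow_add o_apply)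
  also have "\<dots> = (\<Sum>i<m. \<pi> * (w (k * i) * (\<sigma> ^^ (k * i)) v))"
    by (simp add: v funpow_mult_distrib w mult.assoc)
  also have "\<dots> = \<pi> * (\<Sum>i<m. w (k * i) * (\<sigma> ^^ (k * i)) v)"
    by (simp add: sum_distrib_left)
  finally have "(\<Sum>i<m. w (k * i) * (\<sigma> ^^ (k * i)) v) = 1" using \<pi>0 by simp
  then obtain i where "w (k * i) * (\<sigma> ^^ (k * i)) v dvd 1"
    using local_ring_unit_sum[OF local_ring, of "{..<m}" "\<lambda>i. w (k * i) * (\<sigma> ^^ (k * i)) v"] by auto
  then have "v dvd 1" using funpow_unitD dvd_mult_right by blast
  then show ?thesis unfolding \<pi>_def[symmetric] v by simp
qed

lemma inj_on_orbit: "inj_on (\<lambda>i. (\<sigma> ^^ i) y) {..<p}"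
proof (rule linorder_inj_onI')
  fix i j assume ij: "i \<in> {..<p}" "j \<in> {..<p}" "i < j"
  show "(\<sigma> ^^ i) y \<noteq> (\<sigma> ^^ j) y"
  proof
    assume "(\<sigma> ^^ i) y = (\<sigma> ^^ j) y"
    also have "\<dots> = (\<sigma> ^^ i) ((\<sigma> ^^ (j - i)) y)"
      using ij funpow_add[of i "j - i" \<sigma>] by simp
    finally have "(\<sigma> ^^ i) y = (\<sigma> ^^ i) ((\<sigma> ^^ (j - i)) y)" .
    then have "y = (\<sigma> ^^ (j - i)) y" by (rule funpow_inj)
    moreover have "j - i < p" using ij by (simp add: less_imp_diff_less)
    ultimately show False using augmentation_generator_power[of "j - i"] ij moves by simp
  qed
qed

section \<open>Interpolation along the orbit\<close>

lemma coeff_map_hom: "Polynomial.coeff (map_poly \<sigma> P) n = \<sigma> (Polynomial.coeff P n)"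
  by (simp add: coeff_map_poly hom_zero)

lemma degree_map_hom: "degree (map_poly \<sigma> P) \<le> degree P"
  by (rule degree_le) (simp add: coeff_map_hom coeff_eq_0 hom_zero)

lemma poly_map_hom: "poly (map_poly \<sigma> P) (\<sigma> x) = \<sigma> (poly P x)"
  by (induction P) (simp_all add: map_poly_pCons hom_zero hom_add hom_mult)

lemma interpolation_unique:
  assumes "degree P < p" "degree Q < p"
    and eq: "\<And>i. i < p \<Longrightarrow> poly P ((\<sigma> ^^ i) y) = poly Q ((\<sigma> ^^ i) y)"
  shows "P = Q"
proof (rule poly_eqI_degree[where A = "(\<lambda>i. (\<sigma> ^^ i) y) ` {..<p}"])
  show "card ((\<lambda>i. (\<sigma> ^^ i) y) ` {..<p}) > degree P" "card ((\<lambda>i. (\<sigma> ^^ i) y) ` {..<p}) > degree Q"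
    using assms by (simp_all add: card_image[OF inj_on_orbit])
  show "poly P x = poly Q x" if "x \<in> (\<lambda>i. (\<sigma> ^^ i) y) ` {..<p}" for x
    using that by (elim imageE) (simp only: lessThan_iff eq)
qed

text \<open>
  This is Neville's recursion: \<open>P\<close> interpolates at the first \<open>k + 1\<close> nodes and \<open>map_poly \<sigma> P\<close> at the
  same nodes shifted by one, and the step combines the two. The division by
  \<open>\<sigma>\<^sup>k\<^sup>+\<^sup>1 y - y\<close> in the step is exact because that element generates the augmentation ideal,
  where the coefficients of \<open>map_poly \<sigma> P - P\<close> lie.
\<close>

lemma interpolation_exists:
  assumes "k < p"
  shows "\<exists>P. degree P \<le> k \<and> (\<forall>i\<le>k. poly P ((\<sigma> ^^ i) y) = (\<sigma> ^^ i) b)"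
  using assms
proof (induction k)
  case 0
  show ?case by (intro exI[of _ "[:b:]"]) simp
next
  case (Suc k)
  then obtain P where P: "degree P \<le> k" "\<And>i. i \<le> k \<Longrightarrow> poly P ((\<sigma> ^^ i) y) = (\<sigma> ^^ i) b"
    by auto
  define D where "D = map_poly \<sigma> P - P"
  define d where "d = (\<sigma> ^^ Suc k) y - y"
  have dvd: "d dvd \<sigma> y - y"
    unfolding d_def by (rule augmentation_generator_power) (use Suc.prems in auto)
  then have d0: "d \<noteq> 0" using moves by auto
  have "d dvd Polynomial.coeff D n" for n
    using dvd_trans[OF dvd dvd_diff] by (simp add: D_def coeff_map_hom)
  then have "[:d:] dvd D" by (simp add: const_poly_dvd_iff)
  then obtain Q where "D = [:d:] * Q" by (rule dvdE)
  then have Q: "D = Polynomial.smult d Q" by simp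
  have "degree D \<le> k"
    unfolding D_def using P(1) by (intro degree_diff_le) (auto intro: order.trans[OF degree_map_hom])
  then have degQ: "degree Q \<le> k" using Q d0 by simp
  have shift: "poly (map_poly \<sigma> P) ((\<sigma> ^^ Suc i) y) = (\<sigma> ^^ Suc i) b" if "i \<le> k" for i
    using P(2)[OF that] by (simp add: poly_map_hom)
  have dQ: "d * poly Q ((\<sigma> ^^ Suc i) y) = (\<sigma> ^^ Suc i) b - poly P ((\<sigma> ^^ Suc i) y)" if "i \<le> k" for i
  proof -
    have "d * poly Q ((\<sigma> ^^ Suc i) y) = poly D ((\<sigma> ^^ Suc i) y)" by (simp add: Q)
    then show ?thesis by (simp only: D_def poly_diff shift[OF that])
  qed
  define R where "R = P + [:- y, 1:] * Q"
  have R: "poly R x = poly P x + (x - y) * poly Q x" for x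
    by (simp add: R_def algebra_simps)
  have "degree R \<le> Suc k"
    unfolding R_def using P(1) degQ degree_mult_le[of "[:- y, 1:]" Q]
    by (intro degree_add_le) auto
  moreover have "poly R ((\<sigma> ^^ i) y) = (\<sigma> ^^ i) b" if i: "i \<le> Suc k" for i
  proof (cases i)
    case 0
    then show ?thesis using P(2)[of 0] by (simp add: R)
  next
    case (Suc j)
    show ?thesis
    proof (cases "j = k")
      case True
      have "poly R ((\<sigma> ^^ Suc k) y) = poly P ((\<sigma> ^^ Suc k) y) + d * poly Q ((\<sigma> ^^ Suc k) y)"
        unfolding R d_def ..
      also have "\<dots> = (\<sigma> ^^ Suc k) b" using dQ[of k] by simp
      finally show ?thesis using Suc True by simp
    next
      case False
      then have "i \<le> k" "j \<le> k" using i Suc by auto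
      then have "d * poly Q ((\<sigma> ^^ i) y) = 0" using dQ[of j] P(2)[of i] Suc by simp
      then have "poly Q ((\<sigma> ^^ i) y) = 0" using d0 by simp
      then show ?thesis using P(2)[OF \<open>i \<le> k\<close>] by (simp add: R)
    qed
  qed
  ultimately show ?case by blast
qed

text \<open>
  Applying \<open>\<sigma>\<close> to the coefficients shifts the interpolation data cyclically, and a cyclic shift
  of the full orbit poses the same interpolation problem.
\<close>

lemma invariant_coefficients:
  assumes deg: "degree P < p" and P: "\<And>i. i < p \<Longrightarrow> poly P ((\<sigma> ^^ i) y) = (\<sigma> ^^ i) b"
  shows "\<sigma> (Polynomial.coeff P n) = Polynomial.coeff P n"
proof -
  have "map_poly \<sigma> P = P"
  proof (rule interpolation_unique)
    show "degree (map_poly \<sigma> P) < p"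
      using deg degree_map_hom le_less_trans by blast
    fix i assume i: "i < p"
    show "poly (map_poly \<sigma> P) ((\<sigma> ^^ i) y) = poly P ((\<sigma> ^^ i) y)"
    proof (cases i)
      case 0
      have p: "p = Suc (p - 1)" using prime_gt_0_nat[OF prime] by simp
      \<comment> \<open>The node \<open>y\<close> is the image under \<open>\<sigma>\<close> of the last node.\<close>
      have per: "\<sigma> ((\<sigma> ^^ (p - 1)) z) = z" for z
        using order p by (metis comp_apply funpow.simps(2) id_apply)
      have "poly (map_poly \<sigma> P) (\<sigma> ((\<sigma> ^^ (p - 1)) y)) = \<sigma> ((\<sigma> ^^ (p - 1)) b)"
        unfolding poly_map_hom using P[of "p - 1"] p by simp
      then show ?thesis using 0 P[OF i] by (simp only: per funpow_0)
    next
      case (Suc j)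
      then show ?thesis using P[of j] P[of i] i by (simp add: poly_map_hom)
    qed
  qed (rule deg)
  then show ?thesis using coeff_map_hom[of P n] by simp
qed

lemma expansion_exists: "\<exists>a. (\<forall>i. \<sigma> (a i) = a i) \<and> b = (\<Sum>i<p. a i * y ^ i)"
proof -
  have p: "p - 1 < p" using prime_gt_0_nat[OF prime] by simp
  then obtain P where P: "degree P \<le> p - 1" "\<And>i. i \<le> p - 1 \<Longrightarrow> poly P ((\<sigma> ^^ i) y) = (\<sigma> ^^ i) b"
    using interpolation_exists by blast
  have "\<sigma> (Polynomial.coeff P n) = Polynomial.coeff P n" for n
    by (rule invariant_coefficients[where b = b]) (use P p in auto)
  moreover have "b = (\<Sum>i<p. Polynomial.coeff P i * y ^ i)"
  proof -
    have "b = poly P y" using P(2)[of 0] by simp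
    also have "\<dots> = (\<Sum>i\<le>degree P. Polynomial.coeff P i * y ^ i)" by (rule poly_altdef)
    also have "\<dots> = (\<Sum>i<p. Polynomial.coeff P i * y ^ i)"
      using P(1) p by (intro sum.mono_neutral_left) (auto simp: coeff_eq_0)
    finally show ?thesis .
  qed
  ultimately show ?thesis by blast
qed

text \<open>
  A relation with invariant coefficients can be transported by the powers of \<open>\<sigma>\<close>, so equality of
  two expansions in \<open>y\<close> alone makes the two polynomials agree at all \<open>p\<close> nodes.
\<close>

lemma expansion_unique:
  assumes a: "\<And>i. i < p \<Longrightarrow> \<sigma> (a i) = a i" and c: "\<And>i. i < p \<Longrightarrow> \<sigma> (c i) = c i"
    and eq: "(\<Sum>i<p. a i * y ^ i) = (\<Sum>i<p. c i * y ^ i)"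
    and n: "n < p"
  shows "a n = c n"
proof -
  define P where "P f = (\<Sum>i<p. Polynomial.monom (f i) i)" for f :: "nat \<Rightarrow> 'b"
  have coeff: "Polynomial.coeff (P f) n = f n" for f
    using n by (simp add: P_def coeff_sum sum.delta)
  have deg: "degree (P f) < p" for f
    unfolding P_def using prime_gt_0_nat[OF prime]
    by (intro degree_sum_less) (auto intro: le_less_trans[OF degree_monom_le])
  have apply_pow: "(\<sigma> ^^ j) (\<Sum>i<p. f i * y ^ i) = poly (P f) ((\<sigma> ^^ j) y)"
    if "\<And>i. i < p \<Longrightarrow> \<sigma> (f i) = f i" for f j
    by (induction j) (simp_all add: P_def poly_sum poly_monom hom_sum hom_mult hom_power that)
  have "P a = P c"
    by (rule interpolation_unique) (simp_all add: deg a c eq flip: apply_pow)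
  then show ?thesis using coeff by metis
qed

end

section \<open>Cyclic groups of automorphisms\<close>

lemma BijGroup_pow: "f \<in> carrier (BijGroup UNIV) \<Longrightarrow> f [^]\<^bsub>BijGroup UNIV\<^esub> n = f ^^ (n::nat)"
proof (induction n)
  case (Suc n)
  have mult: "g \<otimes>\<^bsub>BijGroup UNIV\<^esub> h = g \<circ> h"
    if "g \<in> carrier (BijGroup UNIV)" "h \<in> carrier (BijGroup UNIV)" for g h :: "'a \<Rightarrow> 'a"
    using that by (auto simp: BijGroup_def compose_def)
  have "f [^]\<^bsub>BijGroup UNIV\<^esub> n \<in> carrier (BijGroup UNIV)"
    using Suc.prems group.is_monoid[OF group_BijGroup] by (rule monoid.nat_pow_closed[rotated])
  then have "f [^]\<^bsub>BijGroup UNIV\<^esub> Suc n = f [^]\<^bsub>BijGroup UNIV\<^esub> n \<circ> f"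
    by (simp only: nat_pow_Suc mult[OF _ Suc.prems])
  also have "\<dots> = f ^^ Suc n"
    by (simp only: Suc.IH[OF Suc.prems] funpow_Suc_right)
  finally show ?case .
qed (simp add: BijGroup_def fun_eq_iff)

lemma funpow_card_eq_id:
  assumes "subgroup G (BijGroup UNIV)" "f \<in> G"
  shows "f ^^ card G = id"
proof -
  interpret H: group "(BijGroup UNIV)\<lparr>carrier := G\<rparr>"
    using subgroup.subgroup_is_group[OF assms(1) group_BijGroup] .
  have "f [^]\<^bsub>(BijGroup UNIV)\<lparr>carrier := G\<rparr>\<^esub> order ((BijGroup UNIV)\<lparr>carrier := G\<rparr>)
      = \<one>\<^bsub>(BijGroup UNIV)\<lparr>carrier := G\<rparr>\<^esub>"
    using assms(2) by (intro H.pow_order_eq_1) simp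
  then have "f [^]\<^bsub>BijGroup UNIV\<^esub> card G = \<one>\<^bsub>BijGroup UNIV\<^esub>"
    by (simp add: order_def flip: monoid.nat_pow_consistent[OF group.is_monoid[OF group_BijGroup]])
  then show ?thesis
    using BijGroup_pow[of f "card G"] subgroup.mem_carrier[OF assms]
    by (simp add: BijGroup_def fun_eq_iff)
qed

lemma generate_fixes:
  assumes "g \<in> generate (BijGroup UNIV) {f}" "f \<in> carrier (BijGroup UNIV)" "f b = b"
  shows "g b = b"
  using assms(1)
proof (induction rule: generate.induct)
  case (inv h)
  then have h: "h = f" by simp
  have "bij f" using assms(2) by (simp add: BijGroup_def Bij_def)
  then have "inv_into UNIV f b = b" using assms(3) by (metis bij_inv_eq_iff)
  moreover have "inv\<^bsub>BijGroup UNIV\<^esub> f = (\<lambda>x\<in>UNIV. inv_into UNIV f x)"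
    using assms(2) by (intro inv_BijGroup) (simp add: BijGroup_def)
  ultimately show ?case using h by simp
next
  case (eng h1 h2)
  have "h1 \<in> carrier (BijGroup UNIV)" "h2 \<in> carrier (BijGroup UNIV)"
    using group.generate_in_carrier[OF group_BijGroup, of "{f}"] assms(2) eng.hyps by blast+
  then have "(h1 \<otimes>\<^bsub>BijGroup UNIV\<^esub> h2) b = h1 (h2 b)"
    by (simp add: BijGroup_def compose_def)
  then show ?case using eng.IH by simp
qed (use assms(3) in \<open>simp_all add: BijGroup_def\<close>)

lemma invariants_generator:
  assumes "group_generator G f" "subgroup G (BijGroup UNIV)"
  shows "invariants G = {b. f b = b}"
  using assms generate_fixes[of _ f] subgroup.mem_carrier[OF assms(2)]
  unfolding group_generator_def invariants_def by blast

theorem proposition5: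
  fixes G :: "('b::idom \<Rightarrow> 'b) set" and \<sigma> :: "'b \<Rightarrow> 'b" and p :: nat and y :: 'b
  assumes "normal_local_ring TYPE('b)"
    and "prime p"
    and "local_automorphism_group G"
    and "card G = p"
    and "group_generator G \<sigma>"
    and "principal_ideal (augmentation_ideal \<sigma>)"
    and "augmentation_generator \<sigma> y"
  shows "is_direct_sum (invariants G) UNIV {..<p} (\<lambda>i. {a * y ^ i | a. a \<in> invariants G})"
proof -
  have sub: "subgroup G (BijGroup UNIV)" and "\<sigma> \<in> G"
    using assms(3,5) by (auto simp: local_automorphism_group_def group_generator_def)
  have auto: "ring_automorphism \<sigma>"
    using assms(3) \<open>\<sigma> \<in> G\<close> by (auto simp: local_automorphism_group_def local_automorphism_def)
  have dvd: "\<sigma> y - y dvd \<sigma> b - b" for b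
  proof -
    have "augmentation_map \<sigma> b \<in> augmentation_ideal \<sigma>"
      unfolding augmentation_ideal_def by (rule module.span_base[OF module_times]) simp
    then have "\<sigma> b - b \<in> module.span (*) {\<sigma> y - y}"
      using assms(7) by (simp add: augmentation_generator_def augmentation_map_def)
    then show ?thesis by (auto simp: module.span_singleton[OF module_times])
  qed
  have "\<sigma> y \<noteq> y"
  proof
    assume "\<sigma> y = y"
    then have fix_all: "\<sigma> b = b" for b using dvd[of b] by simp
    have "g = id" if "g \<in> G" for g
      using that assms(5) generate_fixes[of g \<sigma>] fix_all subgroup.mem_carrier[OF sub \<open>\<sigma> \<in> G\<close>]
      by (auto simp: group_generator_def)
    then have "G = {id}" using \<open>\<sigma> \<in> G\<close> by blast
    then show False using assms(4) prime_gt_1_nat[OF assms(2)] by simp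
  qed
  then interpret cyclic_augmentation \<sigma> p y
    using auto dvd assms(1,2) funpow_card_eq_id[OF sub \<open>\<sigma> \<in> G\<close>] assms(4)
    by unfold_locales (simp_all add: ring_automorphism_def normal_local_ring_def)
  have A: "invariants G = {b. \<sigma> b = b}" by (rule invariants_generator[OF assms(5) sub])
  let ?N = "\<lambda>i. {a * y ^ i | a. a \<in> invariants G}"
  have "is_submodule (invariants G) (?N i)" for i
    unfolding is_submodule_def A
  proof (intro conjI ballI)
    show "0 \<in> {a * y ^ i | a. a \<in> {b. \<sigma> b = b}}"
      by (auto simp: hom_zero intro!: exI[of _ 0])
  next
    fix u v assume "u \<in> {a * y ^ i | a. a \<in> {b. \<sigma> b = b}}" "v \<in> {a * y ^ i | a. a \<in> {b. \<sigma> b = b}}"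
    then obtain a c where "u = a * y ^ i" "v = c * y ^ i" "\<sigma> a = a" "\<sigma> c = c" by blast
    then show "u + v \<in> {a * y ^ i | a. a \<in> {b. \<sigma> b = b}}"
      by (auto simp: hom_add distrib_right intro!: exI[of _ "a + c"])
  next
    fix e u assume "e \<in> {b. \<sigma> b = b}" "u \<in> {a * y ^ i | a. a \<in> {b. \<sigma> b = b}}"
    then obtain a where "u = a * y ^ i" "\<sigma> a = a" "\<sigma> e = e" by blast
    then show "e * u \<in> {a * y ^ i | a. a \<in> {b. \<sigma> b = b}}"
      by (auto simp: hom_mult mult.assoc intro!: exI[of _ "e * a"])
  qed
  moreover have "bij_betw (\<lambda>x. \<Sum>i<p. x i) (\<Pi>\<^sub>E i\<in>{..<p}. ?N i) UNIV"
  proof (rule bij_betwI')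
    fix x z assume x: "x \<in> (\<Pi>\<^sub>E i\<in>{..<p}. ?N i)" and z: "z \<in> (\<Pi>\<^sub>E i\<in>{..<p}. ?N i)"
    from x have "\<forall>i<p. \<exists>a. \<sigma> a = a \<and> x i = a * y ^ i" by (fastforce simp: A PiE_def Pi_def)
    then obtain a where a: "\<And>i. i < p \<Longrightarrow> \<sigma> (a i) = a i" "\<And>i. i < p \<Longrightarrow> x i = a i * y ^ i" by metis
    from z have "\<forall>i<p. \<exists>a. \<sigma> a = a \<and> z i = a * y ^ i" by (fastforce simp: A PiE_def Pi_def)
    then obtain c where c: "\<And>i. i < p \<Longrightarrow> \<sigma> (c i) = c i" "\<And>i. i < p \<Longrightarrow> z i = c i * y ^ i" by metis
    show "((\<Sum>i<p. x i) = (\<Sum>i<p. z i)) = (x = z)"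
    proof
      assume "(\<Sum>i<p. x i) = (\<Sum>i<p. z i)"
      then have "(\<Sum>i<p. a i * y ^ i) = (\<Sum>i<p. c i * y ^ i)" by (simp add: a c)
      then have "\<And>i. i < p \<Longrightarrow> a i = c i" using expansion_unique[of a c] a(1) c(1) by blast
      then show "x = z" using x z by (intro PiE_ext) (auto simp: a c)
    qed simp
  next
    fix b :: 'b
    obtain a where a: "\<forall>i. \<sigma> (a i) = a i" "b = (\<Sum>i<p. a i * y ^ i)"
      using expansion_exists by blast
    show "\<exists>x\<in>(\<Pi>\<^sub>E i\<in>{..<p}. ?N i). b = (\<Sum>i<p. x i)"
      by (rule bexI[of _ "\<lambda>i\<in>{..<p}. a i * y ^ i"]) (use a in \<open>auto simp: A\<close>)
  qed simp
  ultimately show ?thesis unfolding is_direct_sum_def by blast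
qed

end
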